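(* Let $G$ be a finite group, and write $|G/\Phi(G)|=p_1p_2\cdots p_n$ with primes $p_1\leqslant p_2\leqslant\cdots\leqslant p_n$. Then the following statements are equivalent: (1) the factorization graph $\mathfrak{F}(G)$ has no isolated vertices; (2) $\mathfrak{F}(G)$ is connected; (3) for some $m$ (with $0\leqslant m\leqslant n$), $\Phi(G)$ is the intersection of $m$ maximal subgroups $M_1,\ldots,M_m$ of $G$ whose indices in $G$ are the lowest $m$ prime divisors of $|G/\Phi(G)|$ counted with multiplicity, that is, $[G:M_i]=p_i$ for $i=1,\ldots,m$.
   Context: $\Phi(G)$ denotes the Frattini subgroup of $G$. The factorization graph $\mathfrak{F}(G)$ of a finite group $G$ is the simple undirected graph whose vertices are the proper subgroups $H$ of $G$ with $H\nsubseteq\Phi(G)$, two vertices $U,V$ being adjacent if $G=UV$. A graph with no vertices is regarded as connected (and has no isolated vertices). The intersection of an empty family of subgroups of $G$ is $G$. *)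

theory Defs
  imports
    "HOL-Algebra.Coset"
    "HOL-Computational_Algebra.Primes"
    "Graph_Theory.Graph_Theory"
begin

definition maximal_subgroup :: "'a set \<Rightarrow> ('a, 'b) monoid_scheme \<Rightarrow> bool" where
  "maximal_subgroup M G \<longleftrightarrow>
     subgroup M G \<and> M \<noteq> carrier G \<and>
     (\<forall>K. subgroup K G \<and> M \<subseteq> K \<longrightarrow> K = M \<or> K = carrier G)"

(* The intersection with the carrier makes the Frattini subgroup of a group without
   maximal subgroups (e.g. the trivial group) the whole group. *)
definition frattini :: "('a, 'b) monoid_scheme \<Rightarrow> 'a set" where
  "frattini G = carrier G \<inter> \<Inter> {M. maximal_subgroup M G}"

definition subgroup_index :: "('a, 'b) monoid_scheme \<Rightarrow> 'a set \<Rightarrow> nat" where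
  "subgroup_index G H = card (rcosets\<^bsub>G\<^esub> H)"

definition factorization_vertices :: "('a, 'b) monoid_scheme \<Rightarrow> 'a set set" where
  "factorization_vertices G =
     {H. subgroup H G \<and> H \<noteq> carrier G \<and> \<not> H \<subseteq> frattini G}"

(* An undirected graph is a symmetric digraph, as in Graph_Theory. There are no loops,
   since U <#> U = U for a subgroup U; see pair_graph_factorization_graph below. *)
definition factorization_graph :: "('a, 'b) monoid_scheme \<Rightarrow> 'a set pair_pre_digraph" where
  "factorization_graph G =
     \<lparr> pverts = factorization_vertices G,
       parcs = {(U, V). U \<in> factorization_vertices G \<and> V \<in> factorization_vertices G \<and>
                        U <#>\<^bsub>G\<^esub> V = carrier G} \<rparr>"

definition isolated_vertex :: "('v, 'e) pre_digraph \<Rightarrow> 'v \<Rightarrow> bool" where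
  "isolated_vertex \<Gamma> v \<longleftrightarrow> v \<in> verts \<Gamma> \<and> \<not> (\<exists>w \<in> verts \<Gamma>. v \<rightarrow>\<^bsub>\<Gamma>\<^esub> w)"

(* Graph_Theory's notion excludes the null graph, which counts as connected here. *)
definition connected_graph :: "('v, 'e) pre_digraph \<Rightarrow> bool" where
  "connected_graph \<Gamma> \<longleftrightarrow> verts \<Gamma> = {} \<or> Digraph_Component.connected \<Gamma>"

lemma (in group) set_mult_eq_carrier_commute:
  assumes U: "subgroup U G" and V: "subgroup V G" and UV: "U <#> V = carrier G"
  shows "V <#> U = carrier G"
proof
  show "V <#> U \<subseteq> carrier G"
    using U V by (simp add: set_mult_closed subgroup.subset)
  show "carrier G \<subseteq> V <#> U"
  proof
    fix x assume x: "x \<in> carrier G"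
    then have "inv x \<in> U <#> V" using UV by simp
    then obtain u v where uv: "u \<in> U" "v \<in> V" "inv x = u \<otimes> v"
      unfolding set_mult_def by blast
    then have c: "u \<in> carrier G" "v \<in> carrier G"
      using U V by (metis subgroup.mem_carrier)+
    have "x = inv (u \<otimes> v)" using uv(3) x by (metis inv_inv)
    also have "\<dots> = inv v \<otimes> inv u" using c by (simp add: inv_mult_group)
    finally have "x = inv v \<otimes> inv u" .
    moreover have "inv v \<in> V" "inv u \<in> U"
      using uv U V by (simp_all add: subgroup.m_inv_closed)
    ultimately show "x \<in> V <#> U" unfolding set_mult_def by blast
  qed
qed

lemma pverts_factorization_graph: "pverts (factorization_graph G) = factorization_vertices G"
  unfolding factorization_graph_def by (simp only: pair_pre_digraph.simps)

lemma parcs_factorization_graph_iff: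
  "(U, V) \<in> parcs (factorization_graph G) \<longleftrightarrow>
     U \<in> factorization_vertices G \<and> V \<in> factorization_vertices G \<and> U <#>\<^bsub>G\<^esub> V = carrier G"
  unfolding factorization_graph_def by (simp only: pair_pre_digraph.simps mem_Collect_eq prod.case)

lemma (in group) pair_graph_factorization_graph:
  assumes "finite (carrier G)"
  shows "pair_graph (factorization_graph G)"
proof -
  let ?F = "factorization_graph G"
  have "factorization_vertices G \<subseteq> Pow (carrier G)"
    unfolding factorization_vertices_def using subgroup.subset by blast
  then have finv: "finite (pverts ?F)"
    unfolding pverts_factorization_graph using assms by (meson finite_Pow_iff finite_subset)
  have vert: "fst e \<in> pverts ?F" "snd e \<in> pverts ?F" if "e \<in> parcs ?F" for e
    using that parcs_factorization_graph_iff[of "fst e" "snd e" G]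
    unfolding pverts_factorization_graph prod.collapse by blast+
  then have "parcs ?F \<subseteq> pverts ?F \<times> pverts ?F"
    by (intro subsetI) (simp only: mem_Times_iff simp_thms)
  then have fina: "finite (parcs ?F)"
    using finv by (meson finite_SigmaI finite_subset)
  have "(V, U) \<in> parcs ?F" if "(U, V) \<in> parcs ?F" for U V
    using that set_mult_eq_carrier_commute[of U V]
    unfolding parcs_factorization_graph_iff factorization_vertices_def by blast
  then have sym: "symmetric (with_proj ?F)"
    unfolding symmetric_def with_proj_simps by (rule symI)
  have loop: "fst e \<noteq> snd e" if "e \<in> parcs ?F" for e
    using that parcs_factorization_graph_iff[of "fst e" "snd e" G] subgroup_mult_id[of "snd e"]
    unfolding factorization_vertices_def prod.collapse by force
  have wf: "pair_wf_digraph ?F"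
    using vert by (rule pair_wf_digraph.intro)
  have "pair_fin_digraph ?F"
    by (rule pair_fin_digraph.intro[OF wf pair_fin_digraph_axioms.intro[OF finv fina]])
  moreover have "pair_loopfree_digraph ?F"
    by (rule pair_loopfree_digraph.intro[OF wf pair_loopfree_digraph_axioms.intro[OF loop]])
  moreover have "pair_sym_digraph ?F"
    by (rule pair_sym_digraph.intro[OF wf pair_sym_digraph_axioms.intro[OF sym]])
  ultimately show ?thesis
    unfolding pair_graph_def pair_digraph_def pair_pseudo_graph_def by blast
qed

end

theory Submission
  imports Defs "HOL-Algebra.Sylow" "HOL-Algebra.Multiplicative_Group" "HOL-Algebra.Zassenhaus"
begin

text \<open>
  Write \<open>\<Phi>\<close> for the Frattini subgroup. The three conditions turn out to be equivalent to a fourth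
  one, \<open>frattini_supplemented\<close> below: for every \<open>x\<close> outside \<open>\<Phi>\<close> with \<open>x\<^sup>q \<in> \<Phi>\<close>, \<open>q\<close> prime, there is a
  maximal subgroup \<open>M\<close> with \<open>\<langle>x\<rangle>M = G\<close>. Such an \<open>M\<close> has index exactly \<open>q\<close>, because
  \<open>|\<langle>x\<rangle>K| = q|K|\<close> for every subgroup \<open>K\<close> that contains \<open>x\<^sup>q\<close> but not \<open>x\<close>. Everything then follows by
  counting.

  A vertex always contains such an \<open>x\<close>, and a supplement of a proper subgroup can be enlarged to a
  maximal one, which is never contained in \<open>\<Phi>\<close>. So the absence of isolated vertices is the fourth
  condition (\<open>all_vertices_adjacent_iff_supplemented\<close>).

  Connectedness: a nonempty factorization graph has at least two vertices, so it has no isolated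
  vertex when it is connected. Conversely, under the fourth condition every vertex is adjacent to a
  maximal subgroup of prime index, and two distinct such subgroups \<open>M\<close>, \<open>N\<close> are adjacent or have a
  common neighbour (\<open>maximal_subgroups_prime_index_linked\<close>). Different prime indices force \<open>MN = G\<close>.
  If both indices are \<open>p\<close> and another prime \<open>s\<close> divides \<open>|G/\<Phi>|\<close>, a maximal subgroup of index \<open>s\<close> is
  adjacent to both. If \<open>|G/\<Phi>|\<close> is a power of \<open>p\<close>, then \<open>[G : M \<inter> N]\<close> is at least \<open>p\<^sup>2\<close>, so \<open>MN = G\<close>.

  Chains: given the fourth condition, intersect maximal subgroups one at a time. If the current
  intersection \<open>D\<close> has \<open>|D/\<Phi>| = p\<^sub>i p\<^sub>i\<^sub>+\<^sub>1\<dots>p\<^sub>n\<close>, Cauchy's theorem yields \<open>x \<in> D\<close> of order \<open>p\<^sub>i\<close> modulo \<open>\<Phi>\<close>,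
  and a maximal supplement \<open>M\<close> of \<open>\<langle>x\<rangle>\<close> cuts \<open>D\<close> down by the factor \<open>p\<^sub>i\<close>, since \<open>D = \<langle>x\<rangle>(D \<inter> M)\<close>
  (\<open>exists_maximal_chain\<close>). Conversely, let \<open>M\<^sub>1, \<dots>, M\<^sub>m\<close> be given and \<open>D\<^sub>k = M\<^sub>1 \<inter> \<dots> \<inter> M\<^sub>k\<close>. Each
  step of this descending chain has index at most \<open>p\<^sub>k\<close>, and as the chain reaches \<open>\<Phi>\<close> all these bounds
  are attained. For \<open>x\<close> of order \<open>q\<close> modulo \<open>\<Phi>\<close> take the first \<open>i\<close> with \<open>x \<notin> M\<^sub>i\<close>. As
  \<open>x \<in> D\<^sub>i\<^sub>-\<^sub>1\<close>, the prime \<open>q\<close> divides \<open>p\<^sub>i\<dots>p\<^sub>n\<close>, so \<open>q \<ge> p\<^sub>i\<close> by the ordering of the primes; and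
  \<open>q|D\<^sub>i| = |\<langle>x\<rangle>D\<^sub>i| \<le> |D\<^sub>i\<^sub>-\<^sub>1| = p\<^sub>i|D\<^sub>i|\<close> gives \<open>q \<le> p\<^sub>i\<close>. Hence \<open>q = [G : M\<^sub>i]\<close> and
  \<open>\<langle>x\<rangle>M\<^sub>i = G\<close> (\<open>supplemented_of_maximal_chain\<close>).
\<close>

context group
begin

section \<open>Counting in finite groups\<close>

lemma card_subgroup_dvd:
  assumes H: "subgroup H G" and K: "subgroup K G" and HK: "H \<subseteq> K"
  shows "card H dvd card K"
proof -
  interpret K: group "G\<lparr>carrier := K\<rparr>"
    using K by (rule subgroup_imp_group)
  have "subgroup H (G\<lparr>carrier := K\<rparr>)"
    using subgroup_incl[OF H K HK] .
  from K.lagrange[OF this] have "card K = card (rcosets\<^bsub>G\<lparr>carrier := K\<rparr>\<^esub> H) * card H"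
    by (simp add: order_def)
  then show ?thesis by (rule dvdI[OF trans[OF _ mult.commute]])
qed

text \<open>The multiplication map \<open>H \<times> K \<rightarrow> HK\<close> has fibres of size \<open>|H \<inter> K|\<close>: the factorizations of
  \<open>g = ab\<close> are the pairs \<open>(at, t\<^sup>-\<^sup>1b)\<close> with \<open>t \<in> H \<inter> K\<close>.\<close>

lemma card_set_mult:
  assumes H: "subgroup H G" and K: "subgroup K G" and fin: "finite H" "finite K"
  shows "card (H <#> K) * card (H \<inter> K) = card H * card K"
proof -
  have HC: "H \<subseteq> carrier G" and KC: "K \<subseteq> carrier G"
    using H K by (simp_all add: subgroup.subset)
  have "\<exists>h k. h \<in> H \<and> k \<in> K \<and> g = h \<otimes> k" if "g \<in> H <#> K" for g
    using that unfolding set_mult_def by blast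
  then obtain a b where ab: "\<And>g. g \<in> H <#> K \<Longrightarrow> a g \<in> H \<and> b g \<in> K \<and> g = a g \<otimes> b g"
    by metis
  have "bij_betw (\<lambda>(g, t). (a g \<otimes> t, inv t \<otimes> b g)) ((H <#> K) \<times> (H \<inter> K)) (H \<times> K)"
  proof (rule bij_betw_byWitness[where f' = "\<lambda>(h, k). (h \<otimes> k, inv (a (h \<otimes> k)) \<otimes> h)"])
    have 1: "(a g \<otimes> t) \<otimes> (inv t \<otimes> b g) = g" "inv (a g) \<otimes> (a g \<otimes> t) = t"
      if g: "g \<in> H <#> K" and t: "t \<in> H \<inter> K" for g t
    proof -
      have c: "a g \<in> carrier G" "b g \<in> carrier G" "t \<in> carrier G" and e: "g = a g \<otimes> b g"
        using ab[OF g] t HC KC by blast+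
      have "(a g \<otimes> t) \<otimes> (inv t \<otimes> b g) = a g \<otimes> (t \<otimes> (inv t \<otimes> b g))"
        using c by (simp add: m_assoc)
      also have "\<dots> = a g \<otimes> b g" using c by (simp flip: m_assoc)
      finally show "(a g \<otimes> t) \<otimes> (inv t \<otimes> b g) = g" using e by simp
      show "inv (a g) \<otimes> (a g \<otimes> t) = t" using c by (simp flip: m_assoc)
    qed
    then show "\<forall>x\<in>(H <#> K) \<times> (H \<inter> K).
        (case case x of (g, t) \<Rightarrow> (a g \<otimes> t, inv t \<otimes> b g) of
           (h, k) \<Rightarrow> (h \<otimes> k, inv (a (h \<otimes> k)) \<otimes> h)) = x"
      by auto
    have 2: "a (h \<otimes> k) \<otimes> (inv (a (h \<otimes> k)) \<otimes> h) = h"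
        "inv (inv (a (h \<otimes> k)) \<otimes> h) \<otimes> b (h \<otimes> k) = k"
        "inv (a (h \<otimes> k)) \<otimes> h \<in> H" "inv (a (h \<otimes> k)) \<otimes> h \<in> K" "h \<otimes> k \<in> H <#> K"
      if h: "h \<in> H" and k: "k \<in> K" for h k
    proof -
      let ?g = "h \<otimes> k"
      show g: "?g \<in> H <#> K" using h k unfolding set_mult_def by blast
      note abg = ab[OF g]
      have c: "a ?g \<in> carrier G" "b ?g \<in> carrier G" "h \<in> carrier G" "k \<in> carrier G"
        using abg h k HC KC by blast+
      show "a ?g \<otimes> (inv (a ?g) \<otimes> h) = h" using c by (simp flip: m_assoc)
      \<comment> \<open>Both sides are the discrepancy between the chosen factorization of \<open>hk\<close> and \<open>(h, k)\<close>; the left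
        one lies in \<open>H\<close>, the right one in \<open>K\<close>.\<close>
      have e: "inv (a ?g) \<otimes> h = b ?g \<otimes> inv k"
      proof -
        have "inv (a ?g) \<otimes> h = inv (a ?g) \<otimes> ((h \<otimes> k) \<otimes> inv k)"
          using c by (simp add: m_assoc)
        also have "\<dots> = inv (a ?g) \<otimes> ((a ?g \<otimes> b ?g) \<otimes> inv k)" using abg by simp
        also have "\<dots> = inv (a ?g) \<otimes> (a ?g \<otimes> (b ?g \<otimes> inv k))" using c by (simp add: m_assoc)
        also have "\<dots> = b ?g \<otimes> inv k" using c by (simp flip: m_assoc)
        finally show ?thesis .
      qed
      show "inv (inv (a ?g) \<otimes> h) \<otimes> b ?g = k"
        unfolding e using c by (simp add: inv_mult_group m_assoc)
      show "inv (a ?g) \<otimes> h \<in> H"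
        using H abg h by (simp add: subgroup.m_closed subgroup.m_inv_closed)
      show "inv (a ?g) \<otimes> h \<in> K"
        unfolding e using K abg k by (simp add: subgroup.m_closed subgroup.m_inv_closed)
    qed
    then show "\<forall>x\<in>H \<times> K.
        (case case x of (h, k) \<Rightarrow> (h \<otimes> k, inv (a (h \<otimes> k)) \<otimes> h) of
           (g, t) \<Rightarrow> (a g \<otimes> t, inv t \<otimes> b g)) = x"
      by auto
    show "(\<lambda>(g, t). (a g \<otimes> t, inv t \<otimes> b g)) ` ((H <#> K) \<times> (H \<inter> K)) \<subseteq> H \<times> K"
      using ab H K by (auto simp: subgroup.m_closed subgroup.m_inv_closed)
    show "(\<lambda>(h, k). (h \<otimes> k, inv (a (h \<otimes> k)) \<otimes> h)) ` (H \<times> K) \<subseteq> (H <#> K) \<times> (H \<inter> K)"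
      using 2 by auto
  qed
  from bij_betw_same_card[OF this] show ?thesis
    by (simp add: card_cartesian_product)
qed

text \<open>An instance of Dedekind's modular law: it turns a factorization \<open>G = \<langle>x\<rangle>M\<close> into the
  factorization \<open>D = \<langle>x\<rangle>(D \<inter> M)\<close> of any subgroup \<open>D\<close> containing \<open>x\<close>.\<close>

lemma set_mult_Int_modular:
  assumes K: "K \<subseteq> carrier G" and L: "subgroup L G"
    and HL: "H \<subseteq> L" and HK: "H <#> K = carrier G"
  shows "H <#> (L \<inter> K) = L"
proof
  show "H <#> (L \<inter> K) \<subseteq> L"
    using HL L unfolding set_mult_def by (auto intro: subgroup.m_closed)
  show "L \<subseteq> H <#> (L \<inter> K)"
  proof
    fix x assume x: "x \<in> L"
    then have "x \<in> H <#> K" using HK subgroup.subset[OF L] by auto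
    then obtain h k where hk: "h \<in> H" "k \<in> K" "x = h \<otimes> k"
      unfolding set_mult_def by blast
    have "h \<in> carrier G" "k \<in> carrier G"
      using hk HL subgroup.subset[OF L] K by auto
    then have "k = inv h \<otimes> x" using hk by (simp flip: m_assoc)
    moreover have "inv h \<in> L" using subgroup.m_inv_closed[OF L] hk HL by auto
    ultimately have "k \<in> L" using x subgroup.m_closed[OF L] by simp
    then show "x \<in> H <#> (L \<inter> K)" using hk unfolding set_mult_def by blast
  qed
qed

lemma pow_mem_subgroup:
  "subgroup K G \<Longrightarrow> x \<in> K \<Longrightarrow> x [^] (n::nat) \<in> K"
  by (induction n) (auto simp: subgroup.one_closed subgroup.m_closed)

lemma generate_singleton_subset:
  "subgroup K G \<Longrightarrow> x \<in> K \<Longrightarrow> generate G {x} \<subseteq> K"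
  using generate_subgroup_incl[of "{x}" K] by simp

lemma coprime_pow_mem_subgroup:
  assumes K: "subgroup K G" and x: "x \<in> carrier G"
    and a: "x [^] (a::nat) \<in> K" and b: "x [^] (b::nat) \<in> K" and ab: "coprime a b"
  shows "x \<in> K"
proof -
  obtain u v where uv: "u * int a + v * int b = 1"
    using bezout_int[of "int a" "int b"] ab by auto
  have "x [^] (u * int a) \<in> K" "x [^] (v * int b) \<in> K"
    using subgroup_int_pow_closed[OF K] a b x
    by (metis int_pow_int int_pow_pow mult.commute)+
  then have "x [^] (u * int a + v * int b) \<in> K"
    using K x by (simp add: int_pow_mult subgroup.m_closed)
  then show ?thesis using uv x by simp
qed

text \<open>The set \<open>\<langle>x\<rangle>K\<close> is the union of the left cosets \<open>x\<^sup>iK\<close>. They repeat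
  with period \<open>q\<close>, and two of them with \<open>0 \<le> i < j < q\<close> agree only if \<open>x\<^sup>j\<^sup>-\<^sup>i \<in> K\<close>, which together with
  \<open>x\<^sup>q \<in> K\<close> would put \<open>x\<close> into \<open>K\<close> because \<open>j - i\<close> and \<open>q\<close> are coprime.\<close>

lemma card_generate_set_mult:
  assumes fin: "finite (carrier G)" and K: "subgroup K G" and x: "x \<in> carrier G" "x \<notin> K"
    and q: "prime q" and xq: "x [^] (q::nat) \<in> K"
  shows "card (generate G {x} <#> K) = q * card K"
proof -
  have KC: "K \<subseteq> carrier G" using K by (rule subgroup.subset)
  have "bij_betw (\<lambda>(i, k). x [^] i \<otimes> k) ({..<q} \<times> K) (generate G {x} <#> K)"
    unfolding bij_betw_def
  proof
    have lt: "\<not> i < j" if e: "x [^] i \<otimes> k = x [^] j \<otimes> l"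
      and k: "k \<in> K" and l: "l \<in> K" and j: "j < q" for i j k l
    proof
      assume ij: "i < j"
      have c: "k \<in> carrier G" "l \<in> carrier G" using k l KC by blast+
      have "x [^] i \<otimes> (x [^] (j - i) \<otimes> l) = x [^] i \<otimes> k"
        using e ij x c by (simp add: nat_pow_mult flip: m_assoc)
      then have "x [^] (j - i) \<otimes> l = k" using x c by simp
      then have "x [^] (j - i) = k \<otimes> inv l" using x c by (simp add: inv_solve_right)
      then have "x [^] (j - i) \<in> K"
        using K k l by (simp add: subgroup.m_closed subgroup.m_inv_closed)
      moreover have "coprime (j - i) q"
        using prime_imp_coprime[OF q, of "j - i"] ij j nat_dvd_not_less[of "j - i" q]
        by (simp add: coprime_commute)
      ultimately show False using coprime_pow_mem_subgroup[OF K x(1) _ xq] x by blast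
    qed
    show "inj_on (\<lambda>(i, k). x [^] i \<otimes> k) ({..<q} \<times> K)"
    proof (rule inj_onI, clarsimp)
      fix i j k l assume *: "i < q" "j < q" "k \<in> K" "l \<in> K" "x [^] i \<otimes> k = x [^] j \<otimes> l"
      then have "i = j" using lt[of i k j l] lt[of j l i k] by force
      moreover have "k \<in> carrier G" "l \<in> carrier G" using * KC by blast+
      ultimately show "i = j \<and> k = l" using * x by simp
    qed
    show "(\<lambda>(i, k). x [^] i \<otimes> k) ` ({..<q} \<times> K) = generate G {x} <#> K"
    proof
      show "(\<lambda>(i, k). x [^] i \<otimes> k) ` ({..<q} \<times> K) \<subseteq> generate G {x} <#> K"
        unfolding set_mult_def generate_pow_on_finite_carrier[OF fin x(1)] by auto
      show "generate G {x} <#> K \<subseteq> (\<lambda>(i, k). x [^] i \<otimes> k) ` ({..<q} \<times> K)"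
      proof
        fix g assume "g \<in> generate G {x} <#> K"
        then obtain n :: nat and k where k: "k \<in> K" and g: "g = x [^] n \<otimes> k"
          unfolding set_mult_def generate_pow_on_finite_carrier[OF fin x(1)] by auto
        have "x [^] n = x [^] (n mod q) \<otimes> (x [^] q) [^] (n div q)"
          using x by (simp add: nat_pow_pow nat_pow_mult)
        then have "g = x [^] (n mod q) \<otimes> ((x [^] q) [^] (n div q) \<otimes> k)"
          using g x subsetD[OF KC k] by (simp add: m_assoc)
        moreover have "(x [^] q) [^] (n div q) \<otimes> k \<in> K"
          using K k xq by (simp add: pow_mem_subgroup subgroup.m_closed)
        moreover have "n mod q < q" using q by (simp add: prime_gt_0_nat)
        ultimately show "g \<in> (\<lambda>(i, k). x [^] i \<otimes> k) ` ({..<q} \<times> K)"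
          by (intro image_eqI[of _ _ "(n mod q, (x [^] q) [^] (n div q) \<otimes> k)"]) auto
      qed
    qed
  qed
  from bij_betw_same_card[OF this] show ?thesis by (simp add: card_cartesian_product)
qed

text \<open>Dividing the exponent \<open>k\<close> by one prime factor after another, the powers of \<open>y\<close> must leave \<open>K\<close> at
  some step, as they end with \<open>y\<close> itself. Recording that the prime divides \<open>k\<close> gives
  control over it when \<open>k\<close> is a prime power.\<close>

lemma exists_pow_prime_mod_subgroup:
  assumes K: "subgroup K G" and y: "y \<in> carrier G" "y \<notin> K"
    and k: "k > 0" "y [^] (k::nat) \<in> K"
  shows "\<exists>r q. prime q \<and> q dvd k \<and> y [^] (r::nat) \<notin> K \<and> (y [^] r) [^] (q::nat) \<in> K"
  using k
proof (induction k rule: less_induct)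
  case (less k)
  have "k \<noteq> 1" using less.prems y by auto
  then obtain q where q: "prime q" "q dvd k" using prime_factor_nat by blast
  then obtain r where r: "k = q * r" by blast
  show ?case
  proof (cases "y [^] r \<in> K")
    case True
    have "r < k" "r > 0" using r q less.prems prime_gt_1_nat[OF q(1)] by auto
    with less.IH[OF _ _ True] show ?thesis unfolding r by (meson dvd_mult)
  next
    case False
    have "(y [^] r) [^] q \<in> K" using less.prems y by (simp add: nat_pow_pow r mult.commute)
    with False q show ?thesis by blast
  qed
qed

text \<open>Cauchy's theorem relative to \<open>K\<close>: since \<open>q\<close> divides \<open>[D : K]\<close>, a Sylow
  \<open>q\<close>-subgroup of \<open>D\<close> is too large to lie in \<open>K\<close>, and any of its elements outside \<open>K\<close> has
  \<open>q\<close>-power order.\<close>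

lemma Cauchy_mod_subgroup:
  assumes fin: "finite (carrier G)" and K: "subgroup K G" and D: "subgroup D G" and KD: "K \<subseteq> D"
    and c: "card D = card K * c" and q: "prime q" "q dvd c"
  shows "\<exists>x \<in> D. x \<notin> K \<and> x [^] (q::nat) \<in> K"
proof -
  interpret D: group "G\<lparr>carrier := D\<rparr>" using D by (rule subgroup_imp_group)
  have finD: "finite D" using fin D by (metis finite_subset subgroup.subset)
  have D0: "card D \<noteq> 0" using finD subgroup.one_closed[OF D] by auto
  define a where "a = multiplicity q (card D)"
  obtain m where m: "card D = q ^ a * m"
    unfolding a_def using multiplicity_dvd by blast
  have "\<exists>S. subgroup S (G\<lparr>carrier := D\<rparr>) \<and> card S = q ^ a"
    using sylow_thm[OF q(1) D.is_group, of a m] m finD by (simp add: order_def)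
  then obtain S where S: "subgroup S (G\<lparr>carrier := D\<rparr>)" and cS: "card S = q ^ a" by blast
  have SG: "subgroup S G" using incl_subgroup[OF D S] .
  have SD: "S \<subseteq> D" using subgroup.subset[OF S] by simp
  have "\<not> S \<subseteq> K"
  proof
    assume "S \<subseteq> K"
    then have "q ^ a dvd card K" using card_subgroup_dvd[OF SG K] cS by simp
    then have "q ^ a * q dvd card D" unfolding c using q(2) by (rule mult_dvd_mono)
    then have "q ^ Suc a dvd card D" by (simp add: mult.commute)
    moreover have "\<not> is_unit q" using q(1) by auto
    ultimately have "Suc a \<le> multiplicity q (card D)"
      using D0 by (intro multiplicity_geI) auto
    then have "Suc a \<le> a" unfolding a_def .
    then show False by simp
  qed
  then obtain y where y: "y \<in> S" "y \<notin> K" by blast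
  have yC: "y \<in> carrier G" using subgroup.mem_carrier[OF SG y(1)] .
  have "ord y dvd q ^ a"
    unfolding cS[symmetric] generate_pow_card[OF yC]
    using card_subgroup_dvd[OF generate_is_subgroup SG generate_singleton_subset[OF SG y(1)]] yC
    by simp
  then have "y [^] (q ^ a) = \<one>" using pow_eq_id[OF yC] by simp
  then have "y [^] (q ^ a) \<in> K" using subgroup.one_closed[OF K] by simp
  moreover have "q ^ a > 0" using q(1) by (simp add: prime_gt_0_nat)
  ultimately obtain r s where rs: "prime s" "s dvd q ^ a" "y [^] (r::nat) \<notin> K" "(y [^] r) [^] s \<in> K"
    using exists_pow_prime_mod_subgroup[OF K yC y(2)] by blast
  have "s = q" using rs(1,2) q(1) by (metis prime_dvd_power primes_dvd_imp_eq)
  moreover have "y [^] r \<in> D" using pow_mem_subgroup[OF SG y(1)] SD by blast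
  ultimately show ?thesis using rs by blast
qed

section \<open>Maximal subgroups and the Frattini subgroup\<close>

lemma subgroup_frattini: "subgroup (frattini G) G"
proof -
  have "frattini G = \<Inter> (insert (carrier G) {M. maximal_subgroup M G})"
    unfolding frattini_def by simp
  moreover have "subgroup \<dots> G"
    by (rule subgroups_Inter) (auto simp: maximal_subgroup_def subgroup_self)
  ultimately show ?thesis by simp
qed

lemma frattini_subset: "maximal_subgroup M G \<Longrightarrow> frattini G \<subseteq> M"
  unfolding frattini_def by blast

lemma maximal_subgroupD:
  assumes "maximal_subgroup M G"
  shows "subgroup M G" "M \<subseteq> carrier G" "M \<noteq> carrier G"
  using assms subgroup.subset unfolding maximal_subgroup_def by blast+

lemma exists_maximal_subgroup:
  assumes fin: "finite (carrier G)" and H: "subgroup H G" "H \<noteq> carrier G"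
  shows "\<exists>M. maximal_subgroup M G \<and> H \<subseteq> M"
proof -
  let ?A = "{K. subgroup K G \<and> K \<noteq> carrier G}"
  have "?A \<subseteq> Pow (carrier G)" using subgroup.subset by blast
  then have "finite ?A" using fin by (meson finite_Pow_iff finite_subset)
  from finite_has_maximal2[OF this, of H] H
  obtain M where M: "M \<in> ?A" "H \<subseteq> M" "\<forall>b\<in>?A. M \<subseteq> b \<longrightarrow> M = b" by blast
  then have "maximal_subgroup M G" unfolding maximal_subgroup_def by blast
  with M(2) show ?thesis by blast
qed

text \<open>The elements of the Frattini subgroup are non-generators: \<open>H\<close> lies in a maximal subgroup, which
  would absorb \<open>K\<close>. Hence every proper supplement of a proper subgroup is a vertex of the graph.\<close>

lemma supplement_not_subset_frattini:
  assumes fin: "finite (carrier G)" and H: "subgroup H G" "H \<noteq> carrier G"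
    and HK: "H <#> K = carrier G"
  shows "\<not> K \<subseteq> frattini G"
proof
  assume K: "K \<subseteq> frattini G"
  obtain M where M: "maximal_subgroup M G" "H \<subseteq> M"
    using exists_maximal_subgroup[OF fin H] by blast
  have "H <#> K \<subseteq> M <#> M"
    using M(2) K frattini_subset[OF M(1)] by (meson mono_set_mult subset_trans)
  also have "\<dots> = M" using maximal_subgroupD(1)[OF M(1)] by (rule subgroup_mult_id)
  finally show False using HK maximal_subgroupD[OF M(1)] by blast
qed

lemma maximal_subgroup_conjugate:
  assumes M: "maximal_subgroup M G" and g: "g \<in> carrier G"
  shows "maximal_subgroup (g <# M #> inv g) G"
  unfolding maximal_subgroup_def
proof (intro conjI allI impI)
  note MC = maximal_subgroupD(2)[OF M]
  have undo: "inv g <# (g <# K #> inv g) #> g = K" "g <# (inv g <# K #> g) #> inv g = K"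
    if "K \<subseteq> carrier G" for K
    using subgroup_conjugation_is_surj0[of "inv g" K] subgroup_conjugation_is_surj0[of g K] that g
    by simp_all
  have mono: "a <# A #> b \<subseteq> a <# B #> b" if "A \<subseteq> B" for A B a b
    using that unfolding l_coset_def r_coset_def by blast
  show "subgroup (g <# M #> inv g) G"
    using subgroup_conjugation_is_surj2[OF g maximal_subgroupD(1)[OF M]] .
  have C: "inv g <# carrier G #> g = carrier G"
  proof
    show "inv g <# carrier G #> g \<subseteq> carrier G"
      using g unfolding l_coset_def r_coset_def by auto
    have "g <# carrier G #> inv g \<subseteq> carrier G"
      using g unfolding l_coset_def r_coset_def by auto
    from mono[OF this, of "inv g" g] show "carrier G \<subseteq> inv g <# carrier G #> g"
      using undo(1)[of "carrier G"] by (simp only: subset_refl)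
  qed
  show "g <# M #> inv g \<noteq> carrier G"
    using undo(1)[OF MC] C maximal_subgroupD(3)[OF M] by metis
  fix K assume K: "subgroup K G \<and> g <# M #> inv g \<subseteq> K"
  let ?K = "inv g <# K #> g"
  have KC: "K \<subseteq> carrier G" using K subgroup.subset by blast
  have sK: "subgroup ?K G"
    using subgroup_conjugation_is_surj2[of "inv g" K] K g by simp
  have "inv g <# (g <# M #> inv g) #> g \<subseteq> ?K"
    using K by (simp add: mono)
  then have "M \<subseteq> ?K" using undo(1)[OF MC] by simp
  then have "?K = M \<or> ?K = carrier G" using M sK unfolding maximal_subgroup_def by blast
  then show "K = g <# M #> inv g \<or> K = carrier G"
  proof
    assume "?K = M"
    then show ?thesis using undo(2)[OF KC] by simp
  next
    assume "?K = carrier G"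
    then show ?thesis using undo(2)[OF KC] undo(2)[of "carrier G"] C by simp
  qed
qed

text \<open>The Frattini subgroup is an intersection over a conjugation-invariant family.\<close>

lemma normal_frattini: "frattini G \<lhd> G"
proof -
  have "g \<otimes> h \<otimes> inv g \<in> frattini G" if g: "g \<in> carrier G" and h: "h \<in> frattini G" for g h
  proof -
    have hC: "h \<in> carrier G" using h subgroup.mem_carrier[OF subgroup_frattini] by blast
    have "g \<otimes> h \<otimes> inv g \<in> M" if M: "maximal_subgroup M G" for M
    proof -
      have "h \<in> inv g <# M #> inv (inv g)"
        using h frattini_subset[OF maximal_subgroup_conjugate[OF M]] g by blast
      then obtain m where m: "m \<in> M" "h = inv g \<otimes> m \<otimes> g"
        using g unfolding l_coset_def r_coset_def by auto
      have "m \<in> carrier G" using m maximal_subgroupD(2)[OF M] by blast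
      then have "inv g \<otimes> m \<otimes> g = inv g \<otimes> (m \<otimes> g)" using g by (simp add: m_assoc)
      then have "g \<otimes> h = m \<otimes> g" using m g \<open>m \<in> carrier G\<close> by (simp flip: m_assoc)
      then have "g \<otimes> h \<otimes> inv g = m" using g \<open>m \<in> carrier G\<close> by (simp add: m_assoc)
      then show ?thesis using m by simp
    qed
    then show ?thesis unfolding frattini_def using g hC by simp
  qed
  then show ?thesis using normal_inv_iff subgroup_frattini by blast
qed

section \<open>Elements of prime order modulo the Frattini subgroup\<close>

lemma adjacent_vertex_iff_maximal_supplement:
  assumes fin: "finite (carrier G)" and H: "subgroup H G" "H \<noteq> carrier G"
  shows "(\<exists>V \<in> factorization_vertices G. H <#> V = carrier G)
           \<longleftrightarrow> (\<exists>M. maximal_subgroup M G \<and> H <#> M = carrier G)"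
proof
  assume "\<exists>V \<in> factorization_vertices G. H <#> V = carrier G"
  then obtain V where V: "V \<in> factorization_vertices G" "H <#> V = carrier G" by blast
  then obtain M where M: "maximal_subgroup M G" "V \<subseteq> M"
    using exists_maximal_subgroup[OF fin] unfolding factorization_vertices_def by blast
  have "H <#> V \<subseteq> H <#> M" using M(2) by (simp add: mono_set_mult)
  moreover have "H <#> M \<subseteq> carrier G"
    using set_mult_closed subgroup.subset[OF H(1)] maximal_subgroupD(2)[OF M(1)] by blast
  ultimately show "\<exists>M. maximal_subgroup M G \<and> H <#> M = carrier G" using V(2) M(1) by blast
next
  assume "\<exists>M. maximal_subgroup M G \<and> H <#> M = carrier G"
  then obtain M where M: "maximal_subgroup M G" "H <#> M = carrier G" by blast
  then have "M \<in> factorization_vertices G"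
    using supplement_not_subset_frattini[OF fin H M(2)] maximal_subgroupD[OF M(1)]
    unfolding factorization_vertices_def by simp
  with M(2) show "\<exists>V \<in> factorization_vertices G. H <#> V = carrier G" by blast
qed

text \<open>
  The condition on elements of prime order modulo \<open>\<Phi>\<close> through which the graph and the chains of
  maximal subgroups are compared. The index of the supplement is determined by \<open>q\<close>
  (\<open>supplement_prime_index\<close>); it is recorded in the condition because each application needs it.
\<close>

definition frattini_supplemented :: bool where
  "frattini_supplemented \<longleftrightarrow>
     (\<forall>x \<in> carrier G - frattini G. \<forall>q::nat. prime q \<longrightarrow> x [^] q \<in> frattini G \<longrightarrow>
        (\<exists>M. maximal_subgroup M G \<and> generate G {x} <#> M = carrier G \<and> order G = q * card M))"

lemma exists_mem_prime_mod_frattini: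
  assumes fin: "finite (carrier G)" and H: "subgroup H G" "\<not> H \<subseteq> frattini G"
  shows "\<exists>x \<in> H. \<exists>q::nat. x \<notin> frattini G \<and> prime q \<and> x [^] q \<in> frattini G"
proof -
  obtain y where y: "y \<in> H" "y \<notin> frattini G" using H(2) by blast
  have yC: "y \<in> carrier G" using subgroup.mem_carrier[OF H(1) y(1)] .
  have "y [^] order G \<in> frattini G"
    using pow_order_eq_1[OF yC] subgroup.one_closed[OF subgroup_frattini] by simp
  moreover have "order G > 0" using fin order_gt_0_iff_finite by blast
  ultimately obtain r q where "prime q" "y [^] (r::nat) \<notin> frattini G" "(y [^] r) [^] (q::nat) \<in> frattini G"
    using exists_pow_prime_mod_subgroup[OF subgroup_frattini yC y(2)] by blast
  then show ?thesis using pow_mem_subgroup[OF H(1) y(1)] by blast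
qed

lemma supplement_not_mem:
  assumes M: "maximal_subgroup M G" and xM: "generate G {x} <#> M = carrier G"
  shows "x \<notin> M"
proof
  note sM = maximal_subgroupD[OF M]
  assume "x \<in> M"
  then have "generate G {x} <#> M \<subseteq> M <#> M"
    using generate_singleton_subset[OF sM(1)] by (simp add: mono_set_mult)
  then show False using xM sM subgroup_mult_id[OF sM(1)] by blast
qed

lemma supplement_prime_index:
  assumes fin: "finite (carrier G)" and M: "maximal_subgroup M G"
    and x: "x \<in> carrier G" and q: "prime (q::nat)" "x [^] q \<in> frattini G"
    and xM: "generate G {x} <#> M = carrier G"
  shows "order G = q * card M"
proof -
  note sM = maximal_subgroupD[OF M]
  have "x \<notin> M" using supplement_not_mem[OF M xM] .
  moreover have "x [^] q \<in> M" using q(2) frattini_subset[OF M] by blast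
  ultimately show ?thesis
    using card_generate_set_mult[OF fin sM(1) x _ q(1)] xM by (simp add: order_def)
qed

lemma supplemented_vertex:
  assumes fin: "finite (carrier G)" and S: frattini_supplemented
    and H: "subgroup H G" "\<not> H \<subseteq> frattini G"
  shows "\<exists>M q. maximal_subgroup M G \<and> H <#> M = carrier G \<and> prime q \<and> order G = q * card M"
proof -
  obtain x q where x: "x \<in> H" "x \<notin> frattini G" and q: "prime (q::nat)" "x [^] q \<in> frattini G"
    using exists_mem_prime_mod_frattini[OF fin H] by blast
  have "x \<in> carrier G" using subgroup.mem_carrier[OF H(1) x(1)] .
  then obtain M where M: "maximal_subgroup M G" "generate G {x} <#> M = carrier G" "order G = q * card M"
    using S x(2) q unfolding frattini_supplemented_def by blast
  have "carrier G \<subseteq> H <#> M"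
    unfolding M(2)[symmetric]
    using generate_singleton_subset[OF H(1) x(1)] by (simp add: mono_set_mult)
  moreover have "H <#> M \<subseteq> carrier G"
    using set_mult_closed subgroup.subset[OF H(1)] maximal_subgroupD(2)[OF M(1)] by blast
  ultimately show ?thesis using M q(1) by blast
qed

text \<open>A vertex contains an element \<open>x\<close> of prime order modulo \<open>\<Phi>\<close>, and what supplements \<open>\<langle>x\<rangle>\<close> supplements the
  vertex. Conversely the condition on \<open>x\<close> is the one for the vertex \<open>\<langle>x\<rangle>\<close>, unless \<open>x\<close> generates
  \<open>G\<close>, in which case any maximal subgroup will do.\<close>

lemma all_vertices_adjacent_iff_supplemented:
  assumes fin: "finite (carrier G)"
  shows "(\<forall>H \<in> factorization_vertices G. \<exists>V \<in> factorization_vertices G. H <#> V = carrier G)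
           \<longleftrightarrow> frattini_supplemented"
proof
  assume L: "\<forall>H \<in> factorization_vertices G. \<exists>V \<in> factorization_vertices G. H <#> V = carrier G"
  show frattini_supplemented
    unfolding frattini_supplemented_def
  proof (intro ballI allI impI)
    fix x and q :: nat
    assume "x \<in> carrier G - frattini G" and q: "prime q" "x [^] q \<in> frattini G"
    then have x: "x \<in> carrier G" "x \<notin> frattini G" by auto
    have sx: "subgroup (generate G {x}) G" using x by (simp add: generate_is_subgroup)
    have xx: "x \<in> generate G {x}" by (rule generate.incl) simp
    have "\<exists>M. maximal_subgroup M G \<and> generate G {x} <#> M = carrier G"
    proof (cases "generate G {x} = carrier G")
      case True
      obtain M where M: "maximal_subgroup M G" using x unfolding frattini_def by blast
      then have "carrier G <#> M = carrier G"
        using set_mult_carrier_idem maximal_subgroupD(1) by blast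
      then show ?thesis using M True by auto
    next
      case False
      then have "generate G {x} \<in> factorization_vertices G"
        using sx xx x unfolding factorization_vertices_def by blast
      then show ?thesis using L adjacent_vertex_iff_maximal_supplement[OF fin sx False] by blast
    qed
    then show "\<exists>M. maximal_subgroup M G \<and> generate G {x} <#> M = carrier G \<and> order G = q * card M"
      using supplement_prime_index[OF fin _ x(1) q] by blast
  qed
next
  assume S: frattini_supplemented
  show "\<forall>H \<in> factorization_vertices G. \<exists>V \<in> factorization_vertices G. H <#> V = carrier G"
  proof
    fix H assume "H \<in> factorization_vertices G"
    then have H: "subgroup H G" "H \<noteq> carrier G" "\<not> H \<subseteq> frattini G"
      unfolding factorization_vertices_def by auto
    obtain M where "maximal_subgroup M G" "H <#> M = carrier G"
      using supplemented_vertex[OF fin S H(1,3)] by blast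
    then show "\<exists>V \<in> factorization_vertices G. H <#> V = carrier G"
      using adjacent_vertex_iff_maximal_supplement[OF fin H(1,2)] by blast
  qed
qed

section \<open>Chains of maximal subgroups\<close>

lemma subgroup_carrier_Int_maximal:
  assumes "\<And>i. i \<in> I \<Longrightarrow> maximal_subgroup (M i) G"
  shows "subgroup (carrier G \<inter> (\<Inter>i\<in>I. M i)) G"
proof -
  have "subgroup (\<Inter> (insert (carrier G) (M ` I))) G"
    using assms by (intro subgroups_Inter) (auto simp: maximal_subgroup_def subgroup_self)
  then show ?thesis by simp
qed

text \<open>The intersection shrinks towards \<open>\<Phi>\<close> by exactly one prime factor at each step, in the prescribed
  order, so that the product of all \<open>n\<close> primes is used up when \<open>\<Phi>\<close> is reached.\<close>

lemma exists_maximal_chain: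
  fixes p :: "nat \<Rightarrow> nat"
  assumes fin: "finite (carrier G)" and S: frattini_supplemented
    and ord: "order G = card (frattini G) * (\<Prod>i = 1..n. p i)"
    and p: "\<And>i. i \<in> {1..n} \<Longrightarrow> prime (p i)"
  shows "\<exists>M. (\<forall>i \<in> {1..n}. maximal_subgroup (M i) G \<and> order G = p i * card (M i))
             \<and> frattini G = carrier G \<inter> (\<Inter>i \<in> {1..n}. M i)"
proof -
  have "\<exists>M. (\<forall>i \<in> {1..k}. maximal_subgroup (M i) G \<and> order G = p i * card (M i))
           \<and> card (carrier G \<inter> (\<Inter>i \<in> {1..k}. M i)) = card (frattini G) * (\<Prod>i = Suc k..n. p i)"
    if "k \<le> n" for k
    using that
  proof (induction k)
    case 0
    show ?case using ord by (simp add: order_def)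
  next
    case (Suc k)
    from Suc.IH[OF Suc_leD[OF Suc.prems]] obtain M where
      M: "\<forall>i \<in> {1..k}. maximal_subgroup (M i) G \<and> order G = p i * card (M i)" and
      cM: "card (carrier G \<inter> (\<Inter>i \<in> {1..k}. M i)) = card (frattini G) * (\<Prod>i = Suc k..n. p i)"
      by blast
    define D where "D = carrier G \<inter> (\<Inter>i \<in> {1..k}. M i)"
    have D: "subgroup D G" unfolding D_def using M by (intro subgroup_carrier_Int_maximal) blast
    have FD: "frattini G \<subseteq> D"
      unfolding D_def using M frattini_subset subgroup.subset[OF subgroup_frattini] by blast
    have prod: "(\<Prod>i = Suc k..n. p i) = p (Suc k) * (\<Prod>i = Suc (Suc k)..n. p i)"
      using Suc.prems by (simp add: prod.atLeast_Suc_atMost)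
    have pr: "prime (p (Suc k))" using p Suc.prems by simp
    obtain x where x: "x \<in> D" "x \<notin> frattini G" "x [^] p (Suc k) \<in> frattini G"
      using Cauchy_mod_subgroup[OF fin subgroup_frattini D FD cM[folded D_def] pr] prod by auto
    have xC: "x \<in> carrier G" using subgroup.mem_carrier[OF D x(1)] .
    then obtain N where N: "maximal_subgroup N G" "generate G {x} <#> N = carrier G"
      and oN: "order G = p (Suc k) * card N"
      using S x pr unfolding frattini_supplemented_def by blast
    note sN = maximal_subgroupD[OF N(1)]
    have DN: "subgroup (D \<inter> N) G" using subgroups_Inter_pair[OF D sN(1)] .
    have eq: "generate G {x} <#> (D \<inter> N) = D"
      using set_mult_Int_modular[OF sN(2) D generate_singleton_subset[OF D x(1)] N(2)] .
    have "x \<notin> D \<inter> N" using supplement_not_mem[OF N] by blast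
    moreover have "x [^] p (Suc k) \<in> D \<inter> N" using x(3) FD frattini_subset[OF N(1)] by blast
    ultimately have "card D = p (Suc k) * card (D \<inter> N)"
      using card_generate_set_mult[OF fin DN xC _ pr] eq by simp
    then have c: "card (D \<inter> N) = card (frattini G) * (\<Prod>i = Suc (Suc k)..n. p i)"
      using cM[folded D_def] prod pr by (simp add: prime_gt_0_nat)
    define M' where "M' = M(Suc k := N)"
    have "{1..Suc k} = insert (Suc k) {1..k}" by auto
    then have "(\<Inter>i \<in> {1..Suc k}. M' i) = N \<inter> (\<Inter>i \<in> {1..k}. M i)"
      unfolding M'_def by auto
    then have "carrier G \<inter> (\<Inter>i \<in> {1..Suc k}. M' i) = D \<inter> N" unfolding D_def by blast
    moreover have "maximal_subgroup (M' i) G \<and> order G = p i * card (M' i)" if "i \<in> {1..Suc k}" for i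
      using that M N(1) oN unfolding M'_def by (cases "i = Suc k") auto
    ultimately show ?case using c by metis
  qed
  from this[of n] obtain M where
    M: "\<forall>i \<in> {1..n}. maximal_subgroup (M i) G \<and> order G = p i * card (M i)" and
    c: "card (carrier G \<inter> (\<Inter>i \<in> {1..n}. M i)) = card (frattini G)"
    by auto
  have "frattini G \<subseteq> carrier G \<inter> (\<Inter>i \<in> {1..n}. M i)"
    using M frattini_subset subgroup.subset[OF subgroup_frattini] by blast
  then have "frattini G = carrier G \<inter> (\<Inter>i \<in> {1..n}. M i)"
    using c fin by (simp add: card_subset_eq)
  with M show ?thesis by blast
qed

text \<open>The descending chain \<open>D k\<close> loses at most the factor \<open>p (Suc k)\<close> at each step. Bounding from the top
  gives a lower bound for \<open>|D k|\<close> and bounding from the bottom, where the chain is \<open>\<Phi>\<close>, an upper one;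
  they coincide. This pins down \<open>[D k : \<Phi>]\<close>, and an element of \<open>D k\<close> outside \<open>D (Suc k)\<close>
  whose order modulo \<open>\<Phi>\<close> is prime can then only have the order \<open>p (Suc k)\<close>.\<close>

lemma supplemented_of_maximal_chain:
  fixes p :: "nat \<Rightarrow> nat"
  assumes fin: "finite (carrier G)"
    and ord: "order G = card (frattini G) * (\<Prod>i = 1..n. p i)"
    and p: "\<And>i. i \<in> {1..n} \<Longrightarrow> prime (p i)" and mono: "mono_on {1..n} p"
    and mn: "m \<le> n"
    and M: "\<And>i. i \<in> {1..m} \<Longrightarrow> maximal_subgroup (M i) G"
    and oM: "\<And>i. i \<in> {1..m} \<Longrightarrow> order G = p i * card (M i)"
    and F: "frattini G = carrier G \<inter> (\<Inter>i \<in> {1..m}. M i)"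
  shows frattini_supplemented
  unfolding frattini_supplemented_def
proof (intro ballI allI impI)
  fix x and q :: nat
  assume "x \<in> carrier G - frattini G" and q: "prime q" and xq: "x [^] q \<in> frattini G"
  then have x: "x \<in> carrier G" "x \<notin> frattini G" by auto
  define D where "D k = carrier G \<inter> (\<Inter>i \<in> {1..k}. M i)" for k
  define P where "P k = (\<Prod>i = Suc k..n. p i)" for k
  have D: "subgroup (D k) G" if "k \<le> m" for k
    unfolding D_def using that by (intro subgroup_carrier_Int_maximal M) simp
  have finD: "finite (D k)" for k unfolding D_def using fin by simp
  have D0: "D 0 = carrier G" and Dm: "D m = frattini G" unfolding D_def using F by simp_all
  have DSuc: "D (Suc k) = D k \<inter> M (Suc k)" for k
  proof -
    have "{1..Suc k} = insert (Suc k) {1..k}" by auto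
    then show ?thesis unfolding D_def by auto
  qed
  have FD: "frattini G \<subseteq> D k" if "k \<le> m" for k
    unfolding F D_def using that by auto
  have PSuc: "P k = p (Suc k) * P (Suc k)" if "k < m" for k
    unfolding P_def using that mn by (simp add: prod.atLeast_Suc_atMost)
  have p0: "p (Suc k) > 0" if "k < m" for k
    using p[of "Suc k"] that mn by (simp add: prime_gt_0_nat)
  have step: "card (D k) \<le> p (Suc k) * card (D (Suc k))" if k: "k < m" for k
  proof -
    have "Suc k \<in> {1..m}" using k by simp
    note sM = maximal_subgroupD[OF M[OF this]] and o = oM[OF this]
    have finM: "finite (M (Suc k))" using fin sM(2) by (rule rev_finite_subset)
    have "D k <#> M (Suc k) \<subseteq> carrier G"
      using set_mult_closed[OF subgroup.subset[OF D] sM(2)] k by simp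
    then have "card (D k <#> M (Suc k)) \<le> order G"
      unfolding order_def using fin by (rule card_mono[rotated])
    then have "card (D k) * card (M (Suc k)) \<le> order G * card (D (Suc k))"
      using card_set_mult[OF D sM(1) finD finM, of k] k unfolding DSuc
      by (metis less_imp_le mult_le_mono1)
    also have "\<dots> = p (Suc k) * card (D (Suc k)) * card (M (Suc k))"
      unfolding o by simp
    finally show ?thesis
      using finM subgroup.one_closed[OF sM(1)] by (auto simp: card_gt_0_iff)
  qed
  have lower: "card (frattini G) * P k \<le> card (D k)" if "k \<le> m" for k
    using that
  proof (induction k)
    case 0
    show ?case using ord unfolding D0 P_def by (simp add: order_def)
  next
    case (Suc k)
    then have k: "k < m" "k \<le> m" by simp_all
    have "p (Suc k) * (card (frattini G) * P (Suc k)) = card (frattini G) * P k"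
      using PSuc[OF k(1)] by simp
    also have "\<dots> \<le> card (D k)" using Suc.IH k by blast
    also have "\<dots> \<le> p (Suc k) * card (D (Suc k))" using step[OF k(1)] .
    finally show ?case using nat_mult_le_cancel1[OF p0[of k]] Suc.prems by (simp only: Suc_le_eq)
  qed
  have upper: "card (D k) \<le> card (frattini G) * P k" if "k \<le> m" for k
    using that
  proof (induction k rule: inc_induct)
    case base
    have "P m > 0" unfolding P_def using p by (intro prod_pos) (auto simp: prime_gt_0_nat)
    then show ?case unfolding Dm by simp
  next
    case (step k)
    have "card (D k) \<le> p (Suc k) * card (D (Suc k))" using \<open>k < m\<close> by fact
    also have "\<dots> \<le> p (Suc k) * (card (frattini G) * P (Suc k))" using step.IH by simp
    also have "\<dots> = card (frattini G) * P k" using PSuc[OF \<open>k < m\<close>] by simp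
    finally show ?case .
  qed
  have cardD: "card (D k) = card (frattini G) * P k" if "k \<le> m" for k
    using lower[OF that] upper[OF that] by simp
  define i where "i = (LEAST i. x \<notin> D i)"
  have xi: "x \<notin> D i" unfolding i_def by (rule LeastI[of _ m]) (simp add: Dm x)
  have im: "i \<le> m" unfolding i_def by (rule Least_le) (simp add: Dm x)
  have "i \<noteq> 0" using xi x D0 by metis
  then obtain k where k: "i = Suc k" by (cases i) auto
  have xk: "x \<in> D k" using not_less_Least[of k "\<lambda>i. x \<notin> D i"] k i_def by simp
  have km: "k < m" "k \<le> m" "Suc k \<le> m" using im k by auto
  have xM: "x \<notin> M (Suc k)" using xi xk DSuc k by simp
  have cF: "card (frattini G) > 0"
    using fin subgroup.one_closed[OF subgroup_frattini] subgroup.subset[OF subgroup_frattini]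
    by (auto simp: card_gt_0_iff intro: finite_subset)
  have sx: "subgroup (generate G {x}) G" using x by (simp add: generate_is_subgroup)
  note xD = generate_singleton_subset[OF D[OF km(2)] xk]
  \<comment> \<open>\<open>\<langle>x\<rangle>\<Phi>\<close> is a subgroup, as \<open>\<Phi>\<close> is normal, so Lagrange's theorem makes \<open>q\<close> one of the primes that
    remain in \<open>[D k : \<Phi>]\<close>; the smallest of them is \<open>p (Suc k)\<close>.\<close>
  have "p (Suc k) \<le> q"
  proof -
    have "subgroup (generate G {x} <#> frattini G) G"
      using mult_norm_subgroup[OF normal_frattini sx] commut_normal[OF sx normal_frattini] by simp
    moreover have "generate G {x} <#> frattini G \<subseteq> D k <#> D k"
      using xD FD[OF km(2)] by (rule mono_set_mult)
    ultimately have "q * card (frattini G) dvd card (frattini G) * P k"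
      using card_subgroup_dvd[OF _ D[OF km(2)]] subgroup_mult_id[OF D[OF km(2)]]
        card_generate_set_mult[OF fin subgroup_frattini x q xq] cardD[OF km(2)] by metis
    then have "q dvd P k" using cF by (simp add: mult.commute)
    then obtain j where j: "j \<in> {Suc k..n}" "q dvd p j"
      unfolding P_def using q by (auto simp: prime_dvd_prod_iff)
    then have "q = p j" using p[of j] q by (simp add: primes_dvd_imp_eq)
    then show ?thesis using mono_onD[OF mono, of "Suc k" j] j by simp
  qed
  moreover have "q \<le> p (Suc k)"
  proof -
    have "q * card (D (Suc k)) = card (generate G {x} <#> D (Suc k))"
      using card_generate_set_mult[OF fin D[OF km(3)] x(1) _ q] xi xq FD[OF km(3)] k by auto
    also have "generate G {x} <#> D (Suc k) \<subseteq> D k <#> D k"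
      using xD DSuc by (simp add: mono_set_mult)
    then have "card (generate G {x} <#> D (Suc k)) \<le> card (D k)"
      unfolding subgroup_mult_id[OF D[OF km(2)]] using finD by (rule card_mono[rotated])
    also have "\<dots> = p (Suc k) * card (D (Suc k))"
      unfolding cardD[OF km(2)] cardD[OF km(3)] PSuc[OF km(1)] by simp
    finally show ?thesis
      using finD subgroup.one_closed[OF D[OF km(3)]] by (auto simp: card_gt_0_iff)
  qed
  ultimately have qp: "q = p (Suc k)" by simp
  have "Suc k \<in> {1..m}" using km by simp
  note N = M[OF this] and o = oM[OF this]
  have "x [^] q \<in> M (Suc k)" using xq frattini_subset[OF N] by blast
  then have "card (generate G {x} <#> M (Suc k)) = card (carrier G)"
    using card_generate_set_mult[OF fin maximal_subgroupD(1)[OF N] x(1) xM q] o qp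
    by (simp add: order_def)
  moreover have "generate G {x} <#> M (Suc k) \<subseteq> carrier G"
    using set_mult_closed[OF subgroup.subset[OF sx] maximal_subgroupD(2)[OF N]] .
  ultimately have "generate G {x} <#> M (Suc k) = carrier G"
    using fin by (simp add: card_subset_eq)
  then show "\<exists>M. maximal_subgroup M G \<and> generate G {x} <#> M = carrier G \<and> order G = q * card M"
    using N o qp by blast
qed

section \<open>Connectedness of the factorization graph\<close>

text \<open>Since \<open>|HK| = |H||K| / |H \<inter> K| = |G| r / (ab)\<close>, a large index of the intersection makes \<open>HK\<close>
  everything.\<close>

lemma set_mult_eq_carrierI:
  assumes fin: "finite (carrier G)" and H: "subgroup H G" and K: "subgroup K G"
    and oH: "order G = a * card H" and oK: "order G = b * card K"
    and o: "order G = r * card (H \<inter> K)" and le: "a * b \<le> r"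
  shows "H <#> K = carrier G"
proof -
  have sub: "H \<subseteq> carrier G" "K \<subseteq> carrier G" using H K by (simp_all add: subgroup.subset)
  have o0: "order G > 0" using fin order_gt_0_iff_finite by blast
  have "finite H" "finite K" using fin sub by (auto intro: finite_subset)
  from card_set_mult[OF H K this]
  have c: "card (H <#> K) * card (H \<inter> K) = card H * card K" .
  have "a * b * order G * card (H \<inter> K) \<le> r * order G * card (H \<inter> K)"
    using le by simp
  also have "\<dots> = order G * order G" unfolding o by simp
  also have "\<dots> = a * card H * (b * card K)" using oH oK by simp
  also have "\<dots> = a * b * card (H <#> K) * card (H \<inter> K)" using c by (simp add: algebra_simps)
  finally have "a * b * order G * card (H \<inter> K) \<le> a * b * card (H <#> K) * card (H \<inter> K)" .
  moreover have "a * b > 0" "card (H \<inter> K) > 0" using oH oK o o0 by (auto intro: Nat.gr0I)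
  ultimately have "order G \<le> card (H <#> K)" by simp
  moreover have "H <#> K \<subseteq> carrier G" using sub by (rule set_mult_closed)
  ultimately show ?thesis using fin by (simp add: order_def card_seteq)
qed

lemma subgroup_Int_index:
  assumes H: "subgroup H G" and K: "subgroup K G" and oH: "order G = a * card H"
  shows "\<exists>b. card H = b * card (H \<inter> K) \<and> order G = a * b * card (H \<inter> K)"
proof -
  have "card (H \<inter> K) dvd card H"
    using card_subgroup_dvd[OF subgroups_Inter_pair[OF H K] H] by blast
  then obtain b where "card H = card (H \<inter> K) * b" by (rule dvdE)
  then show ?thesis using oH by (intro exI[of _ b]) simp
qed

lemma set_mult_eq_carrier_of_distinct_prime_index:
  assumes fin: "finite (carrier G)" and H: "subgroup H G" and K: "subgroup K G"
    and oH: "order G = a * card H" and oK: "order G = b * card K"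
    and ab: "prime a" "prime b" "a \<noteq> b"
  shows "H <#> K = carrier G"
proof -
  have o0: "order G > 0" using fin order_gt_0_iff_finite by blast
  obtain u where u: "order G = a * u * card (H \<inter> K)"
    using subgroup_Int_index[OF H K oH] by blast
  obtain v where v: "order G = b * v * card (K \<inter> H)"
    using subgroup_Int_index[OF K H oK] by blast
  have "a * u = b * v" using u v o0 by (metis Int_commute mult_cancel2 mult_is_0 neq0_conv)
  moreover have "coprime a b" using ab by (simp add: primes_coprime)
  ultimately have "a * b dvd a * u" by (metis divides_mult dvd_triv_left)
  moreover have "a * u > 0" using u o0 by (auto intro: Nat.gr0I)
  ultimately have "a * b \<le> a * u" by (rule dvd_imp_le)
  with set_mult_eq_carrierI[OF fin H K oH oK u] show ?thesis by blast
qed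

text \<open>For equal indices \<open>p\<close>, the two cases are whether \<open>[G : \<Phi>]\<close> has a prime divisor other than \<open>p\<close>. If
  so, it provides a common neighbour through Cauchy's theorem. If not, \<open>[M : M \<inter> N]\<close> is a
  nontrivial power of \<open>p\<close>, because it divides \<open>[G : \<Phi>]\<close> and \<open>M \<noteq> N\<close>.\<close>

lemma maximal_subgroups_prime_index_linked:
  assumes fin: "finite (carrier G)" and S: frattini_supplemented
    and M: "maximal_subgroup M G" and N: "maximal_subgroup N G" and MN: "M \<noteq> N"
    and oM: "order G = p * card M" and oN: "order G = q * card N" and pq: "prime p" "prime q"
  shows "M <#> N = carrier G
           \<or> (\<exists>K. maximal_subgroup K G \<and> M <#> K = carrier G \<and> K <#> N = carrier G)"
proof (cases "p = q")
  case False
  then show ?thesis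
    using set_mult_eq_carrier_of_distinct_prime_index[OF fin _ _ oM oN pq]
      maximal_subgroupD(1)[OF M] maximal_subgroupD(1)[OF N] by blast
next
  case True
  note sM = maximal_subgroupD[OF M] and sN = maximal_subgroupD[OF N]
  note sub = subgroup.subset[OF subgroup_frattini]
  obtain c where c: "order G = card (frattini G) * c"
    using card_subgroup_dvd[OF subgroup_frattini subgroup_self sub]
    unfolding order_def by (auto elim: dvdE)
  have o0: "order G > 0" using fin order_gt_0_iff_finite by blast
  show ?thesis
  proof (cases "\<exists>s. prime s \<and> s dvd c \<and> s \<noteq> p")
    case True
    then obtain s where s: "prime s" "s dvd c" "s \<noteq> p" by blast
    then obtain x where x: "x \<in> carrier G" "x \<notin> frattini G" "x [^] s \<in> frattini G"
      using Cauchy_mod_subgroup[OF fin subgroup_frattini subgroup_self sub c[unfolded order_def]]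
      by blast
    then obtain K where K: "maximal_subgroup K G" "order G = s * card K"
      using S s(1) unfolding frattini_supplemented_def by blast
    note sK = maximal_subgroupD(1)[OF K(1)]
    have "M <#> K = carrier G" "K <#> N = carrier G"
      using set_mult_eq_carrier_of_distinct_prime_index[OF fin sM(1) sK oM K(2) pq(1) s(1)]
        set_mult_eq_carrier_of_distinct_prime_index[OF fin sK sN(1) K(2) oN s(1) pq(2)]
        s(3) \<open>p = q\<close> by auto
    then show ?thesis using K(1) by blast
  next
    case False
    obtain b where b: "card M = b * card (M \<inter> N)" "order G = p * b * card (M \<inter> N)"
      using subgroup_Int_index[OF sM(1) sN(1) oM] by blast
    \<comment> \<open>Here \<open>b = [M : M \<inter> N]\<close>.\<close>
    have "b \<noteq> 1"
    proof
      assume "b = 1"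
      moreover have "finite M" using fin sM(2) by (rule rev_finite_subset)
      ultimately have "M \<inter> N = M" using b(1) by (simp add: card_subset_eq)
      then show False using M N MN sN(3) unfolding maximal_subgroup_def by blast
    qed
    then obtain s where s: "prime s" "s dvd b" using prime_factor_nat by blast
    have "card (frattini G) dvd card (M \<inter> N)"
      using card_subgroup_dvd[OF subgroup_frattini subgroups_Inter_pair[OF sM(1) sN(1)]]
        frattini_subset[OF M] frattini_subset[OF N] by blast
    then obtain d where d: "card (M \<inter> N) = card (frattini G) * d" by (rule dvdE)
    have "card (frattini G) > 0" using c o0 by (auto intro: Nat.gr0I)
    then have "c = p * b * d" using b(2) c d by (simp add: mult.left_commute)
    then have "s dvd c" using s(2) by (simp add: dvd_mult2)
    then have "p dvd b" using False s by blast
    moreover have "b > 0" using b(2) o0 by (auto intro: Nat.gr0I)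
    ultimately have "p * q \<le> p * b" using \<open>p = q\<close> by (simp add: dvd_imp_le)
    then show ?thesis using set_mult_eq_carrierI[OF fin sM(1) sN(1) oM oN b(2)] by blast
  qed
qed

text \<open>A lone vertex would be a unique maximal subgroup, but then it would equal \<open>\<Phi>\<close>.\<close>

lemma exists_other_vertex:
  assumes fin: "finite (carrier G)" and H: "H \<in> factorization_vertices G"
  shows "\<exists>K \<in> factorization_vertices G. K \<noteq> H"
proof -
  have sH: "subgroup H G" "H \<noteq> carrier G" "\<not> H \<subseteq> frattini G"
    using H unfolding factorization_vertices_def by auto
  obtain M where M: "maximal_subgroup M G" "H \<subseteq> M"
    using exists_maximal_subgroup[OF fin sH(1,2)] by blast
  note sM = maximal_subgroupD[OF M(1)]
  show ?thesis
  proof (cases "H = M")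
    case False
    have "M \<in> factorization_vertices G"
      using sM sH(3) M(2) unfolding factorization_vertices_def by blast
    with False show ?thesis by blast
  next
    case True
    then obtain N where N: "maximal_subgroup N G" "\<not> M \<subseteq> N"
      using sH(3) sM(2) unfolding frattini_def by blast
    note sN = maximal_subgroupD[OF N(1)]
    have "\<not> N \<subseteq> frattini G"
    proof
      assume "N \<subseteq> frattini G"
      then have "N \<subseteq> M" using frattini_subset[OF M(1)] by blast
      then show False using N sM unfolding maximal_subgroup_def by blast
    qed
    then have "N \<in> factorization_vertices G"
      using sN unfolding factorization_vertices_def by blast
    then show ?thesis using N(2) True by blast
  qed
qed

lemma no_isolated_vertex_iff:
  "(\<nexists>H. isolated_vertex (with_proj (factorization_graph G)) H) \<longleftrightarrow>
     (\<forall>H \<in> factorization_vertices G. \<exists>V \<in> factorization_vertices G. H <#> V = carrier G)"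
  unfolding isolated_vertex_def
  by (auto simp: pverts_factorization_graph parcs_factorization_graph_iff)

lemma connected_graph_iff:
  assumes fin: "finite (carrier G)"
  shows "connected_graph (with_proj (factorization_graph G)) \<longleftrightarrow>
     (\<forall>U \<in> factorization_vertices G. \<forall>V \<in> factorization_vertices G.
        U \<rightarrow>\<^sup>*\<^bsub>with_proj (factorization_graph G)\<^esub> V)"
proof -
  interpret F: pair_graph "factorization_graph G"
    using pair_graph_factorization_graph[OF fin] .
  show ?thesis
    unfolding connected_graph_def connected_def strongly_connected_def
    using F.reachable_mk_symmetric_eq[OF F.sym_arcs]
    by (auto simp: pverts_factorization_graph)
qed

text \<open>Two vertices are joined through neighbours \<open>M\<close> and \<open>N\<close> that are maximal subgroups of prime index,
  so that the graph, when connected, has diameter at most four.\<close>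

lemma no_isolated_iff_connected:
  assumes fin: "finite (carrier G)"
  shows "(\<nexists>H. isolated_vertex (with_proj (factorization_graph G)) H)
           \<longleftrightarrow> connected_graph (with_proj (factorization_graph G))"
    (is "?I \<longleftrightarrow> ?C")
proof -
  let ?V = "factorization_vertices G" and ?F = "with_proj (factorization_graph G)"
  interpret F: pair_graph "factorization_graph G"
    using pair_graph_factorization_graph[OF fin] .
  note reach = wf_digraph.reachable_adjI[OF F.wf_digraph_axioms]
    wf_digraph.reachable_trans[OF F.wf_digraph_axioms]
  have adj: "U \<rightarrow>\<^bsub>?F\<^esub> W \<longleftrightarrow> U \<in> ?V \<and> W \<in> ?V \<and> U <#> W = carrier G" for U W
    by (simp add: parcs_factorization_graph_iff)
  show ?thesis
  proof
    assume C: ?C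
    show ?I
      unfolding no_isolated_vertex_iff
    proof
      fix H assume H: "H \<in> ?V"
      obtain K where K: "K \<in> ?V" "K \<noteq> H" using exists_other_vertex[OF fin H] by blast
      have "H \<rightarrow>\<^sup>*\<^bsub>?F\<^esub> K" using C H K unfolding connected_graph_iff[OF fin] by blast
      then have "(H, K) \<in> (arcs_ends ?F)\<^sup>*" by (rule reachable_rtranclI)
      then obtain W where "H \<rightarrow>\<^bsub>?F\<^esub> W" using K(2) by (auto elim: converse_rtranclE)
      then show "\<exists>W \<in> ?V. H <#> W = carrier G" unfolding adj by blast
    qed
  next
    assume ?I
    then have I: "\<forall>H \<in> ?V. \<exists>W \<in> ?V. H <#> W = carrier G" unfolding no_isolated_vertex_iff .
    then have S: frattini_supplemented using all_vertices_adjacent_iff_supplemented[OF fin] by blast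
    have vert: "M \<in> ?V" if "H \<in> ?V" "maximal_subgroup M G" "H <#> M = carrier G" for H M
      using supplement_not_subset_frattini[OF fin _ _ that(3)] that(1) maximal_subgroupD[OF that(2)]
      unfolding factorization_vertices_def by simp
    have nbr: "\<exists>M q. maximal_subgroup M G \<and> U \<rightarrow>\<^bsub>?F\<^esub> M \<and> prime q \<and> order G = q * card M"
      if U: "U \<in> ?V" for U
    proof -
      have "subgroup U G" "\<not> U \<subseteq> frattini G" using U unfolding factorization_vertices_def by auto
      from supplemented_vertex[OF fin S this] show ?thesis
        using vert[OF U] U unfolding adj by blast
    qed
    show ?C
      unfolding connected_graph_iff[OF fin]
    proof (intro ballI)
      fix U W assume U: "U \<in> ?V" and W: "W \<in> ?V"
      obtain M p where M: "maximal_subgroup M G" "U \<rightarrow>\<^bsub>?F\<^esub> M" "prime p" "order G = p * card M"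
        using nbr[OF U] by blast
      obtain N q where N: "maximal_subgroup N G" "W \<rightarrow>\<^bsub>?F\<^esub> N" "prime q" "order G = q * card N"
        using nbr[OF W] by blast
      have MV: "M \<in> ?V" and NV: "N \<in> ?V" using M(2) N(2) unfolding adj by auto
      have "M \<rightarrow>\<^sup>*\<^bsub>?F\<^esub> N"
      proof (cases "M = N")
        case True
        then show ?thesis using MV by (simp add: F.reachable_refl pverts_factorization_graph)
      next
        case False
        from maximal_subgroups_prime_index_linked[OF fin S M(1) N(1) False M(4) N(4) M(3) N(3)]
        show ?thesis
        proof
          assume "M <#> N = carrier G"
          then have "M \<rightarrow>\<^bsub>?F\<^esub> N" unfolding adj using MV NV by blast
          then show ?thesis by (rule reach(1))
        next
          assume "\<exists>K. maximal_subgroup K G \<and> M <#> K = carrier G \<and> K <#> N = carrier G"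
          then obtain K where K: "maximal_subgroup K G" "M <#> K = carrier G" "K <#> N = carrier G"
            by blast
          have "M \<rightarrow>\<^bsub>?F\<^esub> K" "K \<rightarrow>\<^bsub>?F\<^esub> N" unfolding adj using vert[OF MV K(1,2)] MV NV K by blast+
          then show ?thesis by (meson reach)
        qed
      qed
      moreover have "N \<rightarrow>\<^bsub>?F\<^esub> W"
        using N(2) set_mult_eq_carrier_commute[of W N]
        unfolding adj factorization_vertices_def by blast
      ultimately show "U \<rightarrow>\<^sup>*\<^bsub>?F\<^esub> W"
        using M(2) by (meson reach)
    qed
  qed
qed

end

section \<open>The equivalence\<close>

theorem theorem2p2:
  fixes G :: "('a, 'b) monoid_scheme" (structure)
    and p :: "nat \<Rightarrow> nat" and n :: nat
  assumes "group G" and "finite (carrier G)"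
    and "order (G Mod frattini G) = (\<Prod>i = 1..n. p i)"
    and "\<And>i. i \<in> {1..n} \<Longrightarrow> prime (p i)"
    and "mono_on {1..n} p"
  shows "((\<nexists>H. isolated_vertex (with_proj (factorization_graph G)) H)
            \<longleftrightarrow> connected_graph (with_proj (factorization_graph G)))
       \<and> (connected_graph (with_proj (factorization_graph G))
            \<longleftrightarrow> (\<exists>m \<le> n. \<exists>M :: nat \<Rightarrow> 'a set.
                  (\<forall>i \<in> {1..m}. maximal_subgroup (M i) G \<and> subgroup_index G (M i) = p i)
                  \<and> frattini G = carrier G \<inter> (\<Inter>i \<in> {1..m}. M i)))"
proof -
  interpret group G by fact
  note fin = assms(2)
  have ord: "order G = card (frattini G) * (\<Prod>i = 1..n. p i)"
    using lagrange[OF subgroup_frattini] assms(3)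
    by (simp add: FactGroup_def order_def mult.commute)
  have index: "subgroup_index G M = r \<longleftrightarrow> order G = r * card M" if M: "maximal_subgroup M G" for M r
  proof -
    note sM = maximal_subgroupD[OF M]
    have "card M > 0"
      using fin sM(2) subgroup.one_closed[OF sM(1)] by (auto simp: card_gt_0_iff intro: finite_subset)
    then show ?thesis unfolding subgroup_index_def lagrange[OF sM(1), symmetric] by simp
  qed
  have "frattini_supplemented \<longleftrightarrow> (\<exists>m \<le> n. \<exists>M :: nat \<Rightarrow> 'a set.
                  (\<forall>i \<in> {1..m}. maximal_subgroup (M i) G \<and> subgroup_index G (M i) = p i)
                  \<and> frattini G = carrier G \<inter> (\<Inter>i \<in> {1..m}. M i))"
    (is "_ \<longleftrightarrow> ?chain")
  proof
    assume S: frattini_supplemented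
    obtain M where "\<forall>i \<in> {1..n}. maximal_subgroup (M i) G \<and> order G = p i * card (M i)"
        "frattini G = carrier G \<inter> (\<Inter>i \<in> {1..n}. M i)"
      using exists_maximal_chain[OF fin S ord assms(4)] by blast
    moreover from this(1) have "\<forall>i \<in> {1..n}. maximal_subgroup (M i) G \<and> subgroup_index G (M i) = p i"
      using index by blast
    ultimately show ?chain by blast
  next
    assume ?chain
    then obtain m M where mn: "m \<le> n"
      and M: "\<forall>i \<in> {1..m}. maximal_subgroup (M i) G \<and> subgroup_index G (M i) = p i"
      and F: "frattini G = carrier G \<inter> (\<Inter>i \<in> {1..m}. M i)" by blast
    show frattini_supplemented
      by (rule supplemented_of_maximal_chain[OF fin ord assms(4,5) mn _ _ F]) (use M index in blast)+
  qed
  then show ?thesis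
    using no_isolated_iff_connected[OF fin] no_isolated_vertex_iff all_vertices_adjacent_iff_supplemented[OF fin]
    by blast
qed

end
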